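(* Let $A$ be a $\mathbb{K}$-vector space. Polarization $\mu\mapsto(\rho,\psi)$, with inverse depolarization $(\rho,\psi)\mapsto\mu=\rho+\psi$, gives a one-to-one correspondence between the multiplications $\mu$ on $A$ for which $(A,\mu)$ is $G_5$-associative and the pairs $(\rho,\psi)$ of bilinear maps on $A$ for which $(A,\rho,\psi)$ is a nonassociative $(Id+c+c^2)$-Poisson algebra.
   Context: $\mathbb{K}$ is a field of characteristic $0$; multiplications are bilinear maps $A\times A\to A$. The polarization of $\mu$ is the pair $\rho(x,y)=\frac12(\mu(x,y)+\mu(y,x))$, $\psi(x,y)=\frac12(\mu(x,y)-\mu(y,x))$. $(A,\mu)$ is $G_5$-associative (i.e. $(Id+c+c^2)$-associative) if $\mathcal{A}_\mu(x,y,z)+\mathcal{A}_\mu(y,z,x)+\mathcal{A}_\mu(z,x,y)=0$ for all $x,y,z\in A$, where $\mathcal{A}_\mu(x,y,z)=\mu(\mu(x,y),z)-\mu(x,\mu(y,z))$. Let $\mathcal{L}(\rho,\psi)(x,y,z)=\psi(x,\rho(y,z))-\rho(y,\psi(x,z))-\rho(\psi(x,y),z)$. A nonassociative $(Id+c+c^2)$-Poisson algebra $(A,\rho,\psi)$ is a vector space with a commutative multiplication $\rho$ and a Lie bracket $\psi$ such that $\mathcal{L}(\rho,\psi)(x,y,z)+\mathcal{L}(\rho,\psi)(y,z,x)+\mathcal{L}(\rho,\psi)(z,x,y)=0$ for all $x,y,z\in A$. *)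

theory Defs
  imports Complex_Main
begin

text \<open>The vector space \<open>A\<close> is given by a type \<open>'a\<close> of vectors and a scalar multiplication
  \<open>s\<close> over a field of characteristic 0.\<close>

definition bilinear_mult ::
    "('k::field_char_0 \<Rightarrow> 'a::ab_group_add \<Rightarrow> 'a) \<Rightarrow> ('a \<Rightarrow> 'a \<Rightarrow> 'a) \<Rightarrow> bool" where
  "bilinear_mult s \<mu> \<longleftrightarrow>
     (\<forall>x. Vector_Spaces.linear s s (\<lambda>y. \<mu> x y)) \<and>
     (\<forall>y. Vector_Spaces.linear s s (\<lambda>x. \<mu> x y))"

definition associator ::
    "('a::ab_group_add \<Rightarrow> 'a \<Rightarrow> 'a) \<Rightarrow> 'a \<Rightarrow> 'a \<Rightarrow> 'a \<Rightarrow> 'a" where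
  "associator \<mu> x y z = \<mu> (\<mu> x y) z - \<mu> x (\<mu> y z)"

definition G5_associative :: "('a::ab_group_add \<Rightarrow> 'a \<Rightarrow> 'a) \<Rightarrow> bool" where
  "G5_associative \<mu> \<longleftrightarrow>
     (\<forall>x y z. associator \<mu> x y z + associator \<mu> y z x + associator \<mu> z x y = 0)"

definition polarization ::
    "('k::field_char_0 \<Rightarrow> 'a::ab_group_add \<Rightarrow> 'a) \<Rightarrow> ('a \<Rightarrow> 'a \<Rightarrow> 'a)
       \<Rightarrow> ('a \<Rightarrow> 'a \<Rightarrow> 'a) \<times> ('a \<Rightarrow> 'a \<Rightarrow> 'a)" where
  "polarization s \<mu> =
     (\<lambda>x y. s (1 / 2) (\<mu> x y + \<mu> y x), \<lambda>x y. s (1 / 2) (\<mu> x y - \<mu> y x))"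

definition depolarization ::
    "('a::ab_group_add \<Rightarrow> 'a \<Rightarrow> 'a) \<times> ('a \<Rightarrow> 'a \<Rightarrow> 'a) \<Rightarrow> ('a \<Rightarrow> 'a \<Rightarrow> 'a)" where
  "depolarization = (\<lambda>(\<rho>, \<psi>). \<lambda>x y. \<rho> x y + \<psi> x y)"

definition lie_bracket ::
    "('k::field_char_0 \<Rightarrow> 'a::ab_group_add \<Rightarrow> 'a) \<Rightarrow> ('a \<Rightarrow> 'a \<Rightarrow> 'a) \<Rightarrow> bool" where
  "lie_bracket s \<psi> \<longleftrightarrow>
     bilinear_mult s \<psi> \<and> (\<forall>x. \<psi> x x = 0) \<and>
     (\<forall>x y z. \<psi> x (\<psi> y z) + \<psi> y (\<psi> z x) + \<psi> z (\<psi> x y) = 0)"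

definition Leibniz_defect ::
    "('a::ab_group_add \<Rightarrow> 'a \<Rightarrow> 'a) \<Rightarrow> ('a \<Rightarrow> 'a \<Rightarrow> 'a) \<Rightarrow> 'a \<Rightarrow> 'a \<Rightarrow> 'a \<Rightarrow> 'a" where
  "Leibniz_defect \<rho> \<psi> x y z = \<psi> x (\<rho> y z) - \<rho> y (\<psi> x z) - \<rho> (\<psi> x y) z"

text \<open>Nonassociative \<open>(Id + c + c\<^sup>2)\<close>-Poisson algebra; \<open>\<rho>\<close> is not assumed associative.\<close>

definition cyclic_Poisson_algebra ::
    "('k::field_char_0 \<Rightarrow> 'a::ab_group_add \<Rightarrow> 'a)
       \<Rightarrow> ('a \<Rightarrow> 'a \<Rightarrow> 'a) \<Rightarrow> ('a \<Rightarrow> 'a \<Rightarrow> 'a) \<Rightarrow> bool" where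
  "cyclic_Poisson_algebra s \<rho> \<psi> \<longleftrightarrow>
     bilinear_mult s \<rho> \<and> (\<forall>x y. \<rho> x y = \<rho> y x) \<and> lie_bracket s \<psi> \<and>
     (\<forall>x y z. Leibniz_defect \<rho> \<psi> x y z + Leibniz_defect \<rho> \<psi> y z x
              + Leibniz_defect \<rho> \<psi> z x y = 0)"

end

theory Submission
  imports Defs
begin

text \<open>Write \<open>\<mu> = \<rho> + \<psi>\<close> with \<open>\<rho>\<close> symmetric and \<open>\<psi>\<close> antisymmetric. In the cyclic sum of the
  associator of \<open>\<mu>\<close> the terms \<open>\<rho>\<rho>\<close> and \<open>\<rho>\<psi>\<close> cancel, and what is left is \<open>-2 (J + P)\<close>, where
  \<open>J\<close> is the Jacobiator of \<open>\<psi>\<close> and \<open>P\<close> is the cyclic sum of \<open>\<psi> x (\<rho> y z)\<close>. Since \<open>J\<close> changes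
  sign under swapping two arguments while \<open>P\<close> does not, the sum vanishes identically iff both
  \<open>J\<close> and \<open>P\<close> do. Finally \<open>P\<close> equals the cyclic sum of the Leibniz defect.\<close>

definition jacobiator :: "('a::ab_group_add \<Rightarrow> 'a \<Rightarrow> 'a) \<Rightarrow> 'a \<Rightarrow> 'a \<Rightarrow> 'a \<Rightarrow> 'a" where
  "jacobiator \<psi> x y z = \<psi> x (\<psi> y z) + \<psi> y (\<psi> z x) + \<psi> z (\<psi> x y)"

definition cyclic_mixed ::
    "('a::ab_group_add \<Rightarrow> 'a \<Rightarrow> 'a) \<Rightarrow> ('a \<Rightarrow> 'a \<Rightarrow> 'a) \<Rightarrow> 'a \<Rightarrow> 'a \<Rightarrow> 'a \<Rightarrow> 'a" where
  "cyclic_mixed \<rho> \<psi> x y z = \<psi> x (\<rho> y z) + \<psi> y (\<rho> z x) + \<psi> z (\<rho> x y)"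

lemma bilinear_mult_iff:
  assumes "vector_space s"
  shows "bilinear_mult s \<mu> \<longleftrightarrow>
    (\<forall>x y z. \<mu> x (y + z) = \<mu> x y + \<mu> x z) \<and> (\<forall>x y z. \<mu> (x + y) z = \<mu> x z + \<mu> y z) \<and>
    (\<forall>c x y. \<mu> x (s c y) = s c (\<mu> x y)) \<and> (\<forall>c x y. \<mu> (s c x) y = s c (\<mu> x y))"
  using assms unfolding bilinear_mult_def Vector_Spaces.linear_iff by blast

lemma biadditive_minus:
  fixes \<mu> :: "'a::ab_group_add \<Rightarrow> 'b::ab_group_add \<Rightarrow> 'c::ab_group_add"
  shows "(\<And>x y z. \<mu> x (y + z) = \<mu> x y + \<mu> x z) \<Longrightarrow> \<mu> x (- y) = - \<mu> x y"
    and "(\<And>x y z. \<mu> (x + y) z = \<mu> x z + \<mu> y z) \<Longrightarrow> \<mu> (- u) v = - \<mu> u v"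
  using additive.minus[of "\<mu> x"] additive.minus[of "\<lambda>u. \<mu> u v"]
  by (simp_all add: additive_def)

context
  fixes \<rho> \<psi> :: "'a::ab_group_add \<Rightarrow> 'a \<Rightarrow> 'a"
  assumes add: "\<And>x y z. \<rho> x (y + z) = \<rho> x y + \<rho> x z" "\<And>x y z. \<rho> (x + y) z = \<rho> x z + \<rho> y z"
      "\<And>x y z. \<psi> x (y + z) = \<psi> x y + \<psi> x z" "\<And>x y z. \<psi> (x + y) z = \<psi> x z + \<psi> y z"
    and sym: "\<And>x y. \<rho> x y = \<rho> y x"
    and antisym: "\<And>x y. \<psi> x y = - \<psi> y x"
begin

text \<open>A transposition reverses the cyclic order: each term keeps its outer argument and has
  its inner pair reversed. The symmetry of the inner product therefore decides the sign, here and in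
  \<open>cyclic_mixed_swap\<close>.\<close>

lemma jacobiator_swap: "jacobiator \<psi> y x z = - jacobiator \<psi> x y z"
  using antisym[of x z] antisym[of y x] antisym[of z y]
  by (simp add: jacobiator_def biadditive_minus(1)[of \<psi>, OF add(3)])

lemma cyclic_mixed_swap: "cyclic_mixed \<rho> \<psi> y x z = cyclic_mixed \<rho> \<psi> x y z"
  using sym[of x z] sym[of y x] sym[of z y] by (simp add: cyclic_mixed_def)

text \<open>Under the cyclic sum the second terms of the associators can be shifted so that
  \<open>\<mu> (\<mu> x y) z\<close> meets \<open>- \<mu> z (\<mu> x y)\<close>, where
  \<open>\<mu>\<close> is the sum of \<open>\<rho>\<close> and \<open>\<psi>\<close>. Such a
  commutator is \<open>- 2 \<psi> z (\<mu> x y)\<close>, and \<open>\<mu> x y\<close> splits into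
  its two parts. The factor 2 is written \<open>T + T\<close> because no scalars act here.\<close>

lemma cyclic_associator:
  fixes x y z
  defines "T \<equiv> jacobiator \<psi> x y z + cyclic_mixed \<rho> \<psi> x y z"
  shows "associator (\<lambda>x y. \<rho> x y + \<psi> x y) x y z + associator (\<lambda>x y. \<rho> x y + \<psi> x y) y z x +
    associator (\<lambda>x y. \<rho> x y + \<psi> x y) z x y = - (T + T)"
  \<comment> \<open>These instances move every inner product into the second argument of the outer
    one.\<close>
  using sym[of "\<rho> x y" z] sym[of "\<rho> y z" x] sym[of "\<rho> z x" y]
    sym[of "\<psi> x y" z] sym[of "\<psi> y z" x] sym[of "\<psi> z x" y]
    antisym[of "\<rho> x y" z] antisym[of "\<rho> y z" x] antisym[of "\<rho> z x" y]
    antisym[of "\<psi> x y" z] antisym[of "\<psi> y z" x] antisym[of "\<psi> z x" y]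
  by (simp add: T_def associator_def jacobiator_def cyclic_mixed_def add algebra_simps)

text \<open>The terms with outer \<open>\<rho>\<close> cancel in pairs:
  \<open>- \<rho> y (\<psi> x z)\<close> from the first defect against
  \<open>- \<rho> (\<psi> z x) y\<close> from the third, and cyclically.\<close>

lemma cyclic_Leibniz_defect:
  "Leibniz_defect \<rho> \<psi> x y z + Leibniz_defect \<rho> \<psi> y z x + Leibniz_defect \<rho> \<psi> z x y =
    cyclic_mixed \<rho> \<psi> x y z"
  using sym[of "\<psi> x y" z] sym[of "\<psi> y z" x] sym[of "\<psi> z x" y]
    antisym[of x z] antisym[of y x] antisym[of z y]
  by (simp add: Leibniz_defect_def cyclic_mixed_def biadditive_minus(1)[of \<rho>, OF add(1)])

text \<open>\<open>double\<close> excludes 2-torsion. It is applied twice: to remove the factor 2 of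
  \<open>cyclic_associator\<close>, and to separate the two summands once the swap has shown them
  equal.\<close>

lemma G5_associative_sum_iff:
  assumes double: "\<And>v::'a. v + v = 0 \<Longrightarrow> v = 0"
  shows "G5_associative (\<lambda>x y. \<rho> x y + \<psi> x y) \<longleftrightarrow>
    (\<forall>x y z. jacobiator \<psi> x y z = 0) \<and> (\<forall>x y z. cyclic_mixed \<rho> \<psi> x y z = 0)" (is "?L \<longleftrightarrow> ?R")
proof
  assume ?L
  then have T: "jacobiator \<psi> x y z + cyclic_mixed \<rho> \<psi> x y z = 0" for x y z
    unfolding G5_associative_def cyclic_associator by (metis double neg_equal_0_iff_equal)
  have "cyclic_mixed \<rho> \<psi> x y z = 0" for x y z
  proof -
    have "cyclic_mixed \<rho> \<psi> x y z = jacobiator \<psi> x y z"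
      using T[of y x z] by (simp add: jacobiator_swap[of y x] cyclic_mixed_swap[of y x])
    then show ?thesis
      using T[of x y z] double by metis
  qed
  with T show ?R by simp
next
  assume ?R
  then show ?L unfolding G5_associative_def cyclic_associator by simp
qed

end

context vector_space
begin

lemma double_eq_0:
  fixes v :: 'b
  assumes "(2::'a) \<noteq> 0" "v + v = 0"
  shows "v = 0"
proof -
  have "scale 2 v = v + v"
    by (metis one_add_one scale_left_distrib scale_one)
  with assms show ?thesis by simp
qed

end

context
  fixes s :: "'k::field_char_0 \<Rightarrow> 'a::ab_group_add \<Rightarrow> 'a"
  assumes vs: "vector_space s"
begin

interpretation vector_space s by (rule vs)

lemma half_double: "s (1 / 2) (v + v) = v"
  by (simp add: scale_right_distrib flip: scale_left_distrib)

lemma depolarization_polarization: "depolarization (polarization s \<mu>) = \<mu>"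
proof -
  have "s (1 / 2) (\<mu> x y + \<mu> y x) + s (1 / 2) (\<mu> x y - \<mu> y x) = \<mu> x y" for x y
    using half_double[of "\<mu> x y"]
    by (metis scale_right_distrib add.assoc add.commute diff_add_cancel)
  then show ?thesis
    by (simp add: depolarization_def polarization_def)
qed

lemma polarization_depolarization:
  assumes "\<And>x y. \<rho> x y = \<rho> y x" "\<And>x y. \<psi> x y = - \<psi> y x"
  shows "polarization s (depolarization (\<rho>, \<psi>)) = (\<rho>, \<psi>)"
proof -
  have "s (1 / 2) (\<rho> x y + \<psi> x y + (\<rho> y x + \<psi> y x)) = \<rho> x y"
    and "s (1 / 2) (\<rho> x y + \<psi> x y - (\<rho> y x + \<psi> y x)) = \<psi> x y" for x y
    using half_double[of "\<rho> x y"] half_double[of "\<psi> x y"] assms(1)[of y x] assms(2)[of y x]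
    by simp_all
  then show ?thesis
    by (simp add: depolarization_def polarization_def)
qed

text \<open>Bridges the alternating law in \<open>lie_bracket\<close> and the antisymmetry that
  \<open>polarization\<close> produces. One direction rests on characteristic 0, the other on
  expanding \<open>\<psi> (x + y) (x + y)\<close>.\<close>

lemma antisym_iff_alternating:
  "(\<forall>x y. \<psi> x y = - \<psi> y x) \<longleftrightarrow> (\<forall>x. \<psi> x x = 0)" if "bilinear_mult s \<psi>"
proof
  assume "\<forall>x y. \<psi> x y = - \<psi> y x"
  then show "\<forall>x. \<psi> x x = 0"
    using double_eq_0 by (metis add.right_inverse zero_neq_numeral)
next
  assume alt: "\<forall>x. \<psi> x x = 0"
  have "\<psi> x y + \<psi> y x = 0" for x y
  proof -
    have "\<psi> (x + y) (x + y) = \<psi> x x + \<psi> y y + (\<psi> x y + \<psi> y x)"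
      using that by (simp add: bilinear_mult_iff[OF vs])
    with alt show ?thesis by simp
  qed
  then show "\<forall>x y. \<psi> x y = - \<psi> y x"
    by (metis add_eq_0_iff2)
qed

text \<open>In this form the correspondence reduces to splitting a bilinear map uniquely into a
  symmetric and an antisymmetric part.\<close>

lemma cyclic_Poisson_algebra_iff:
  "cyclic_Poisson_algebra s \<rho> \<psi> \<longleftrightarrow>
    bilinear_mult s \<rho> \<and> bilinear_mult s \<psi> \<and> (\<forall>x y. \<rho> x y = \<rho> y x) \<and> (\<forall>x y. \<psi> x y = - \<psi> y x) \<and>
    G5_associative (depolarization (\<rho>, \<psi>))"
\<comment> \<open>Each side implies these conditions, the left one through
  \<open>antisym_iff_alternating\<close>, so both sides are false when they fail.\<close>
proof (cases "bilinear_mult s \<rho> \<and> bilinear_mult s \<psi> \<and> (\<forall>x y. \<rho> x y = \<rho> y x) \<and>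
    (\<forall>x y. \<psi> x y = - \<psi> y x)")
  case True
  then have bil: "bilinear_mult s \<rho>" "bilinear_mult s \<psi>"
    and sym: "\<And>x y. \<rho> x y = \<rho> y x" and antisym: "\<And>x y. \<psi> x y = - \<psi> y x"
    and alt: "\<forall>x. \<psi> x x = 0"
    using antisym_iff_alternating by blast+
  have add: "\<And>x y z. \<rho> x (y + z) = \<rho> x y + \<rho> x z" "\<And>x y z. \<rho> (x + y) z = \<rho> x z + \<rho> y z"
      "\<And>x y z. \<psi> x (y + z) = \<psi> x y + \<psi> x z" "\<And>x y z. \<psi> (x + y) z = \<psi> x z + \<psi> y z"
    using bil by (simp_all add: bilinear_mult_iff[OF vs])
  have double: "v = 0" if "v + v = 0" for v :: 'a
    using double_eq_0 that by (metis zero_neq_numeral)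
  have cyc: "Leibniz_defect \<rho> \<psi> x y z + Leibniz_defect \<rho> \<psi> y z x +
      Leibniz_defect \<rho> \<psi> z x y = cyclic_mixed \<rho> \<psi> x y z" for x y z
    by (rule cyclic_Leibniz_defect) (fact add sym antisym)+
  have "G5_associative (depolarization (\<rho>, \<psi>)) \<longleftrightarrow>
      (\<forall>x y z. jacobiator \<psi> x y z = 0) \<and> (\<forall>x y z. cyclic_mixed \<rho> \<psi> x y z = 0)"
    unfolding depolarization_def prod.case
    by (rule G5_associative_sum_iff) (fact add sym antisym double)+
  moreover have "lie_bracket s \<psi> \<longleftrightarrow> (\<forall>x y z. jacobiator \<psi> x y z = 0)"
    using bil alt by (simp only: lie_bracket_def jacobiator_def simp_thms)
  ultimately show ?thesis
    using True unfolding cyclic_Poisson_algebra_def cyc by argo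
next
  case False
  then show ?thesis
    unfolding cyclic_Poisson_algebra_def lie_bracket_def using antisym_iff_alternating by blast
qed

lemma bilinear_mult_depolarization:
  assumes "bilinear_mult s \<rho>" "bilinear_mult s \<psi>"
  shows "bilinear_mult s (depolarization (\<rho>, \<psi>))"
  using assms unfolding bilinear_mult_iff[OF vs] depolarization_def
  by (simp add: algebra_simps)

lemma bilinear_mult_polarization:
  assumes "bilinear_mult s \<mu>"
  shows "bilinear_mult s (fst (polarization s \<mu>))" "bilinear_mult s (snd (polarization s \<mu>))"
  using assms unfolding bilinear_mult_iff[OF vs] polarization_def
  by (simp_all add: algebra_simps)

lemma polarization_symmetries:
  "fst (polarization s \<mu>) x y = fst (polarization s \<mu>) y x"
  "snd (polarization s \<mu>) x y = - snd (polarization s \<mu>) y x"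
  by (simp_all add: polarization_def add.commute flip: scale_minus_right)

end

theorem mainTheorem4:
  fixes s :: "'k::field_char_0 \<Rightarrow> 'a::ab_group_add \<Rightarrow> 'a"
  assumes "vector_space s"
  defines "\<M> \<equiv> {\<mu>. bilinear_mult s \<mu> \<and> G5_associative \<mu>}"
    and "\<P> \<equiv> {(\<rho>, \<psi>). cyclic_Poisson_algebra s \<rho> \<psi>}"
  shows "bij_betw (polarization s) \<M> \<P> \<and> bij_betw depolarization \<P> \<M> \<and>
    (\<forall>\<mu>\<in>\<M>. depolarization (polarization s \<mu>) = \<mu>) \<and>
    (\<forall>p\<in>\<P>. polarization s (depolarization p) = p)"
proof -
  note vs = assms(1)
  have dp: "\<forall>\<mu>\<in>\<M>. depolarization (polarization s \<mu>) = \<mu>"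
    using depolarization_polarization[OF vs] by blast
  have pd: "\<forall>p\<in>\<P>. polarization s (depolarization p) = p"
    unfolding \<P>_def cyclic_Poisson_algebra_iff[OF vs]
    using polarization_depolarization[OF vs] by blast
  have "polarization s \<mu> \<in> \<P>" if "\<mu> \<in> \<M>" for \<mu>
  proof -
    \<comment> \<open>The pair of projections collapses and depolarizes back to
      \<open>\<mu>\<close>, so the last condition becomes the assumption on
      \<open>\<mu>\<close>.\<close>
    have "cyclic_Poisson_algebra s (fst (polarization s \<mu>)) (snd (polarization s \<mu>))"
      unfolding cyclic_Poisson_algebra_iff[OF vs] prod.collapse depolarization_polarization[OF vs]
    proof (intro conjI allI)
      show "bilinear_mult s (fst (polarization s \<mu>))" "bilinear_mult s (snd (polarization s \<mu>))"
        "G5_associative \<mu>"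
        using that bilinear_mult_polarization[OF vs] by (simp_all add: \<M>_def)
    qed (fact polarization_symmetries[OF vs])+
    then show ?thesis by (simp add: \<P>_def case_prod_beta)
  qed
  then have pol: "polarization s ` \<M> \<subseteq> \<P>" by blast
  have depol: "depolarization ` \<P> \<subseteq> \<M>"
    unfolding \<P>_def \<M>_def cyclic_Poisson_algebra_iff[OF vs]
    using bilinear_mult_depolarization[OF vs] by blast
  show ?thesis
    using bij_betw_byWitness[OF dp pd pol depol] bij_betw_byWitness[OF pd dp depol pol] dp pd
    by blast
qed

end
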